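(* Let $N\ge 2$, let $C\in M_N(\mathbb{R})$, and let $f:[0,1]\to\mathbb{R}$ be strictly convex and continuous with $f\in C^1((0,1])$. Let $x,y\in\mathcal{P}_N$ and for $\gamma\in(0,\infty)$ let $P^\gamma$ be the $(f,\gamma)$-coupling between $x,y$. Then the two functions on $(0,\infty)$ sending $\gamma$ to $\mathcal{C}^\gamma(x,y)$ and to $-\mathcal{D}_f(P^\gamma,x\otimes y)$ are increasing (in the non-strict sense). If either $\mathcal{C}^{\gamma_0}(x,y)=\mathcal{C}^{\gamma_1}(x,y)$ or $\mathcal{D}_f(P^{\gamma_0},x\otimes y)=\mathcal{D}_f(P^{\gamma_1},x\otimes y)$ holds for $\gamma_0,\gamma_1\in(0,\infty)$, then $P^{\gamma_0}=P^{\gamma_1}$. Moreover, if $\operatorname{supp}x\otimes y$ is not $C$-cyclically monotone and $f'(0)=-\infty$, then both functions are strictly increasing on $(0,\infty)$.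
   Context: $\mathcal{P}_N=\{x\in\mathbb{R}^N: x_i\ge 0,\ \sum_i x_i=1\}$. For $x,y\in\mathcal{P}_N$, $\Pi(x,y)$ is the set of couplings: matrices $\Pi=(\pi_{ij})\in M_N(\mathbb{R})$ with $\pi_{ij}\ge 0$, $\sum_k\pi_{ik}=x_i$, $\sum_k\pi_{kj}=y_j$ for all $i,j$. $(x\otimes y)_{ij}=x_iy_j$. $\operatorname{supp}x\otimes y=\{(i,j): x_iy_j\ne 0\}$. $\langle C,\Pi\rangle=\sum_{i,j}c_{ij}\pi_{ij}$. A subset $S\subset\{1,\dots,N\}^2$ is $C$-cyclically monotone if $\sum_{m=1}^M c_{i_mj_m}\le\sum_{m=1}^M c_{i_{\sigma(m)}j_m}$ for every $M\in\mathbb{N}$, every family $\{(i_m,j_m)\}_{m=1}^M$ of points of $S$ and every permutation $\sigma$ of $\{1,\dots,M\}$. Bregman divergence: $f'(0):=\lim_{\varepsilon\downarrow 0}f'(\varepsilon)\in[-\infty,\infty)$, with the convention $\pm\infty\cdot 0=0$; $D_f(r,r_0)=f(r)-f(r_0)-f'(r_0)(r-r_0)$ for $r,r_0\in[0,1]$, and $\mathcal{D}_f(\Pi,\widetilde\Pi)=\sum_{i,j=1}^N D_f(\pi_{ij},\widetilde\pi_{ij})$. (For $\Pi\in\Pi(x,y)$, the entries with $x_iy_j=0$ contribute $0$ to $\mathcal{D}_f(\Pi,x\otimes y)$, which is finite and nonnegative.) For $\gamma>0$, $\mathcal{F}^\gamma_{x,y}(\Pi)=\langle C,\Pi\rangle+\gamma\mathcal{D}_f(\Pi,x\otimes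 y)$ on $\Pi(x,y)$; an $(f,\gamma)$-coupling between $x,y$ is a minimizer of $\mathcal{F}^\gamma_{x,y}$ over $\Pi(x,y)$ (it exists and is unique for $\gamma>0$). $\mathcal{C}^\gamma(x,y)=\langle C,P^\gamma\rangle$. *)

theory Defs
  imports "HOL-Analysis.Analysis"
begin

definition prob_simplex :: "(real^'n) set" where
  "prob_simplex = {x. (\<forall>i. 0 \<le> x $ i) \<and> (\<Sum>i\<in>UNIV. x $ i) = 1}"

definition couplings :: "real^'n \<Rightarrow> real^'n \<Rightarrow> (real^'n^'n) set" where
  "couplings x y = {A. (\<forall>i j. 0 \<le> A $ i $ j) \<and>
     (\<forall>i. (\<Sum>k\<in>UNIV. A $ i $ k) = x $ i) \<and>
     (\<forall>j. (\<Sum>k\<in>UNIV. A $ k $ j) = y $ j)}"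

definition tensor :: "real^'n \<Rightarrow> real^'n \<Rightarrow> real^'n^'n" where
  "tensor x y = (\<chi> i j. x $ i * y $ j)"

definition mat_supp :: "real^'n^'n \<Rightarrow> ('n \<times> 'n) set" where
  "mat_supp A = {(i, j). A $ i $ j \<noteq> 0}"

definition cyclically_monotone :: "real^'n^'n \<Rightarrow> ('n \<times> 'n) set \<Rightarrow> bool" where
  "cyclically_monotone C S \<longleftrightarrow>
     (\<forall>(M::nat) (i :: nat \<Rightarrow> 'n) (j :: nat \<Rightarrow> 'n) \<sigma>.
        (\<forall>m\<in>{1..M}. (i m, j m) \<in> S) \<and> \<sigma> permutes {1..M} \<longrightarrow>
        (\<Sum>m=1..M. C $ i m $ j m) \<le> (\<Sum>m=1..M. C $ i (\<sigma> m) $ j m))"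

definition strictly_convex_on :: "real set \<Rightarrow> (real \<Rightarrow> real) \<Rightarrow> bool" where
  "strictly_convex_on S f \<longleftrightarrow> convex S \<and>
     (\<forall>r\<in>S. \<forall>s\<in>S. \<forall>t. r \<noteq> s \<and> 0 < t \<and> t < 1 \<longrightarrow>
        f ((1 - t) * r + t * s) < (1 - t) * f r + t * f s)"

text \<open>
  Only the values of \<open>f\<close> on \<open>[0,1]\<close> matter below, so derivatives are taken within that
  interval; in particular the derivative at \<open>1\<close> is one-sided.
\<close>

definition C1_on_Ioc :: "(real \<Rightarrow> real) \<Rightarrow> bool" where
  "C1_on_Ioc f \<longleftrightarrow>
     (\<exists>g. (\<forall>t\<in>{0<..1}. (f has_real_derivative g t) (at t within {0..1})) \<and>
          continuous_on {0<..1} g)"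

definition bregman_slope :: "(real \<Rightarrow> real) \<Rightarrow> real \<Rightarrow> ereal" where
  "bregman_slope f r =
     (if r = 0 then Lim (at_right 0) (\<lambda>e. ereal (vector_derivative f (at e within {0..1})))
      else ereal (vector_derivative f (at r within {0..1})))"

text \<open>
  The product on \<open>ereal\<close> satisfies \<open>\<plusminus>\<infinity> * 0 = 0\<close>, so \<open>D\<^sub>f(0,0) = 0\<close> even when the slope at \<open>0\<close>
  is \<open>-\<infinity>\<close>, while then \<open>D\<^sub>f(r,0) = \<infinity>\<close> for \<open>r > 0\<close>.
\<close>

definition bregman :: "(real \<Rightarrow> real) \<Rightarrow> real \<Rightarrow> real \<Rightarrow> ereal" where
  "bregman f r r0 = ereal (f r) - ereal (f r0) - bregman_slope f r0 * ereal (r - r0)"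

definition mat_bregman :: "(real \<Rightarrow> real) \<Rightarrow> real^'n^'n \<Rightarrow> real^'n^'n \<Rightarrow> ereal" where
  "mat_bregman f A B = (\<Sum>i\<in>UNIV. \<Sum>j\<in>UNIV. bregman f (A $ i $ j) (B $ i $ j))"

text \<open>The inner product \<open>C \<bullet> A\<close> on matrices is the entrywise sum of \<open>C $ i $ j * A $ i $ j\<close>.\<close>

definition reg_cost ::
  "(real \<Rightarrow> real) \<Rightarrow> real^'n^'n \<Rightarrow> real^'n \<Rightarrow> real^'n \<Rightarrow> real \<Rightarrow> real^'n^'n \<Rightarrow> ereal" where
  "reg_cost f C x y \<gamma> A = ereal (C \<bullet> A) + ereal \<gamma> * mat_bregman f A (tensor x y)"

definition is_coupling_min ::
  "(real \<Rightarrow> real) \<Rightarrow> real^'n^'n \<Rightarrow> real^'n \<Rightarrow> real^'n \<Rightarrow> real \<Rightarrow> real^'n^'n \<Rightarrow> bool" where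
  "is_coupling_min f C x y \<gamma> A \<longleftrightarrow> is_arg_min (reg_cost f C x y \<gamma>) (\<lambda>B. B \<in> couplings x y) A"

text \<open>
  For \<open>x\<close>, \<open>y\<close> in the simplex, \<open>\<gamma> > 0\<close>, and \<open>f\<close> strictly convex and continuous on \<open>[0,1]\<close> and
  \<open>C\<^sup>1\<close> on \<open>(0,1]\<close>, there is exactly one minimizer, so the description below denotes it.
\<close>

definition min_coupling ::
  "(real \<Rightarrow> real) \<Rightarrow> real^'n^'n \<Rightarrow> real^'n \<Rightarrow> real^'n \<Rightarrow> real \<Rightarrow> real^'n^'n" where
  "min_coupling f C x y \<gamma> = (THE A. is_coupling_min f C x y \<gamma> A)"

definition min_cost ::
  "(real \<Rightarrow> real) \<Rightarrow> real^'n^'n \<Rightarrow> real^'n \<Rightarrow> real^'n \<Rightarrow> real \<Rightarrow> real" where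
  "min_cost f C x y \<gamma> = C \<bullet> min_coupling f C x y \<gamma>"

definition min_divergence ::
  "(real \<Rightarrow> real) \<Rightarrow> real^'n^'n \<Rightarrow> real^'n \<Rightarrow> real^'n \<Rightarrow> real \<Rightarrow> ereal" where
  "min_divergence f C x y \<gamma> = mat_bregman f (min_coupling f C x y \<gamma>) (tensor x y)"

end

theory Submission
  imports Defs
begin

text \<open>
  The functional to be minimised is a sum \<open>c + \<gamma> E\<close> of a linear cost \<open>c\<close> and a divergence \<open>E\<close> on the
  compact convex set of couplings.  There \<open>E\<close> is real-valued, continuous and strictly convex,
  because the entries of a coupling vanish wherever \<open>x \<otimes> y\<close> does.  Hence minimisers exist and are
  unique.

  Monotonicity is a general fact about a weighted sum of two objectives: adding the optimality
  inequalities of the minimisers \<open>P\<^sub>0\<close>, \<open>P\<^sub>1\<close> for weights \<open>\<gamma>\<^sub>0 < \<gamma>\<^sub>1\<close> gives \<open>E P\<^sub>1 \<le> E P\<^sub>0\<close>, and then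
  optimality of \<open>P\<^sub>0\<close> gives \<open>c P\<^sub>0 \<le> c P\<^sub>1\<close> (\<open>argmin_tradeoff\<close>).  If either inequality is an equality,
  both are, so \<open>P\<^sub>1\<close> is also optimal for \<open>\<gamma>\<^sub>0\<close> and uniqueness gives \<open>P\<^sub>0 = P\<^sub>1\<close>.

  For strictness it remains to exclude \<open>P\<^sub>0 = P\<^sub>1 = P\<close>.  When \<open>f'(0) = -\<infinity>\<close>, moving from \<open>P\<close> towards
  \<open>x \<otimes> y\<close> gains infinitely fast at an entry where \<open>P\<close> vanishes and \<open>x \<otimes> y\<close> does not, so \<open>P\<close>
  is positive on the whole support of \<open>x \<otimes> y\<close> (\<open>minimizer_positive\<close>).  Then every matrix \<open>H\<close> with
  zero row and column sums, supported there, is a two-sided admissible direction at \<open>P\<close>, and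
  stationarity reads \<open>\<langle>C, H\<rangle> + \<gamma> dE(P) H = 0\<close>.  If this holds for two values of \<open>\<gamma>\<close>, then
  \<open>\<langle>C, H\<rangle> = 0\<close> (\<open>cost_balanced_zero\<close>).  Rearranging a finite family of points of the
  support by a permutation is such a direction, so all the inequalities of cyclical monotonicity
  hold, as equalities.
\<close>

section \<open>Minimisers of a weighted sum of two objectives\<close>

lemma argmin_tradeoff:
  fixes c E :: "'a \<Rightarrow> real"
  assumes "a < b" "0 \<le> a"
    and 0: "c p + a * E p \<le> c q + a * E q"
    and 1: "c q + b * E q \<le> c p + b * E p"
  shows "c p \<le> c q" "E q \<le> E p"
proof -
  have "(b - a) * (E q - E p) \<le> 0"
    using 0 1 by (simp add: algebra_simps)
  then show E: "E q \<le> E p"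
    using \<open>a < b\<close> by (simp add: mult_le_0_iff)
  then have "a * E q \<le> a * E p"
    using \<open>0 \<le> a\<close> by (rule mult_left_mono)
  then show "c p \<le> c q"
    using 0 by simp
qed

section \<open>Couplings\<close>

lemma couplings_nonneg: "A \<in> couplings x y \<Longrightarrow> 0 \<le> A $ i $ j"
  by (simp add: couplings_def)

lemma couplings_le_row:
  assumes "A \<in> couplings x y" shows "A $ i $ j \<le> x $ i"
proof -
  have "A $ i $ j \<le> (\<Sum>k\<in>UNIV. A $ i $ k)"
    by (rule member_le_sum) (use assms in \<open>auto simp: couplings_def\<close>)
  then show ?thesis using assms by (simp add: couplings_def)
qed

lemma couplings_le_col:
  assumes "A \<in> couplings x y" shows "A $ i $ j \<le> y $ j"
proof -
  have "A $ i $ j \<le> (\<Sum>k\<in>UNIV. A $ k $ j)"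
    using member_le_sum[of i UNIV "\<lambda>k. A $ k $ j"] assms by (auto simp: couplings_def)
  then show ?thesis using assms by (simp add: couplings_def)
qed

lemma prob_simplex_le_1:
  assumes "x \<in> prob_simplex" shows "x $ i \<le> 1"
proof -
  have "x $ i \<le> (\<Sum>k\<in>UNIV. x $ k)"
    by (rule member_le_sum) (use assms in \<open>auto simp: prob_simplex_def\<close>)
  then show ?thesis using assms by (simp add: prob_simplex_def)
qed

lemma couplings_entry:
  assumes "x \<in> prob_simplex" "A \<in> couplings x y"
  shows "A $ i $ j \<in> {0..1}"
  using couplings_nonneg[OF assms(2), of i j] couplings_le_row[OF assms(2), of i j]
    prob_simplex_le_1[OF assms(1), of i] by auto

lemma couplings_vanish:
  assumes "A \<in> couplings x y" "tensor x y $ i $ j = 0"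
  shows "A $ i $ j = 0"
  using assms(2) couplings_nonneg[OF assms(1), of i j] couplings_le_row[OF assms(1), of i j]
    couplings_le_col[OF assms(1), of i j]
  by (auto simp: tensor_def)

lemma tensor_in_couplings:
  assumes "x \<in> prob_simplex" "y \<in> prob_simplex"
  shows "tensor x y \<in> couplings x y"
  using assms
  by (simp add: couplings_def tensor_def prob_simplex_def
      flip: sum_distrib_left sum_distrib_right)

lemma convex_couplings: "convex (couplings x y)"
  by (rule convexI)
    (auto simp: couplings_def sum.distrib add_nonneg_nonneg simp flip: sum_distrib_left distrib_right)

lemma closed_couplings: "closed (couplings x y)"
  unfolding couplings_def
  by (intro closed_Collect_conj closed_Collect_all closed_Collect_le closed_Collect_eq
      continuous_intros)

lemma bounded_couplings:
  fixes x y :: "real^'n"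
  assumes "x \<in> prob_simplex" shows "bounded (couplings x y)"
proof (rule boundedI)
  fix A assume A: "A \<in> couplings x y"
  have row: "norm (A $ i) \<le> x $ i" for i
  proof -
    have "norm (A $ i) \<le> (\<Sum>j\<in>UNIV. \<bar>A $ i $ j\<bar>)"
      by (rule norm_le_l1_cart)
    also have "\<dots> = x $ i"
      using A by (simp add: couplings_def)
    finally show ?thesis .
  qed
  have "norm A \<le> (\<Sum>i\<in>UNIV. norm (A $ i))"
    unfolding norm_vec_def by (rule L2_set_le_sum) simp
  also have "\<dots> \<le> (\<Sum>i\<in>UNIV. x $ i)"
    by (rule sum_mono) (rule row)
  finally show "norm A \<le> 1"
    using assms by (simp add: prob_simplex_def)
qed

lemma compact_couplings: "x \<in> prob_simplex \<Longrightarrow> compact (couplings x y)"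
  by (simp add: compact_eq_bounded_closed bounded_couplings closed_couplings)

lemma couplings_perturb:
  assumes "P \<in> couplings x y"
    and "\<And>i. (\<Sum>j\<in>UNIV. H $ i $ j) = 0" "\<And>j. (\<Sum>i\<in>UNIV. H $ i $ j) = 0"
    and "\<And>i j. 0 \<le> P $ i $ j + t * H $ i $ j"
  shows "P + t *\<^sub>R H \<in> couplings x y"
  using assms by (simp add: couplings_def sum.distrib flip: sum_distrib_left)

section \<open>The divergence as a strictly convex real function\<close>

text \<open>
  At a vanishing reference entry the derivative below need not exist; for couplings it multiplies
  the difference of two zero entries, in agreement with the convention \<open>\<plusminus>\<infinity> * 0 = 0\<close>.
\<close>

definition real_bregman :: "(real \<Rightarrow> real) \<Rightarrow> real^'n^'n \<Rightarrow> real^'n^'n \<Rightarrow> real" where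
  "real_bregman f B A = (\<Sum>p\<in>UNIV. f (A $ fst p $ snd p) - f (B $ fst p $ snd p)
     - vector_derivative f (at (B $ fst p $ snd p) within {0..1})
       * (A $ fst p $ snd p - B $ fst p $ snd p))"

lemma mat_bregman_eq_real:
  assumes "\<And>i j. B $ i $ j = 0 \<Longrightarrow> A $ i $ j = 0"
  shows "mat_bregman f A B = ereal (real_bregman f B A)"
proof -
  have "bregman f (A $ i $ j) (B $ i $ j) = ereal (f (A $ i $ j) - f (B $ i $ j)
      - vector_derivative f (at (B $ i $ j) within {0..1}) * (A $ i $ j - B $ i $ j))" for i j
    using assms[of i j] by (auto simp: bregman_def bregman_slope_def simp flip: zero_ereal_def)
  then show ?thesis
    by (simp add: mat_bregman_def real_bregman_def sum.cartesian_product case_prod_unfold)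
qed

lemma continuous_on_real_bregman:
  assumes "continuous_on {0..1} f" "\<And>A i j. A \<in> K \<Longrightarrow> A $ i $ j \<in> {0..1}"
  shows "continuous_on K (real_bregman f B)"
  unfolding real_bregman_def
  by (intro continuous_intros continuous_on_compose2[OF assms(1)]) (use assms(2) in auto)

definition convexity_gap :: "(real \<Rightarrow> real) \<Rightarrow> real \<Rightarrow> real \<Rightarrow> real \<Rightarrow> real" where
  "convexity_gap f t a b = f ((1 - t) * a + t * b) - ((1 - t) * f a + t * f b)"

lemma convexity_gap_nonpos:
  assumes "strictly_convex_on S f" "a \<in> S" "b \<in> S" "0 \<le> t" "t \<le> 1"
  shows "convexity_gap f t a b \<le> 0"
proof (cases "a = b \<or> t = 0 \<or> t = 1")
  case True
  then show ?thesis by (auto simp: convexity_gap_def algebra_simps)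
next
  case False
  then have "a \<noteq> b" "0 < t" "t < 1"
    using assms by auto
  with assms show ?thesis
    by (fastforce simp: convexity_gap_def strictly_convex_on_def)
qed

text \<open>
  Keeping the convexity gap of a single entry serves twice: a negative gap gives strict convexity,
  and the size of the gap at an entry where \<open>f\<close> has slope \<open>-\<infinity>\<close> forces minimisers to be positive.
\<close>

lemma real_bregman_convex_gap:
  assumes sc: "strictly_convex_on {0..1} f" and t: "0 \<le> t" "t \<le> 1"
    and A: "\<And>i j. A $ i $ j \<in> {0..1}" and A': "\<And>i j. A' $ i $ j \<in> {0..1}"
  shows "real_bregman f B ((1 - t) *\<^sub>R A + t *\<^sub>R A')
    \<le> (1 - t) * real_bregman f B A + t * real_bregman f B A'
      + convexity_gap f t (A $ i $ j) (A' $ i $ j)"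
proof -
  let ?g = "\<lambda>p. convexity_gap f t (A $ fst p $ snd p) (A' $ fst p $ snd p)"
  have "real_bregman f B ((1 - t) *\<^sub>R A + t *\<^sub>R A')
      - ((1 - t) * real_bregman f B A + t * real_bregman f B A') = (\<Sum>p\<in>UNIV. ?g p)"
    unfolding real_bregman_def sum_distrib_left sum.distrib[symmetric] sum_subtractf[symmetric]
    by (rule sum.cong) (auto simp: convexity_gap_def algebra_simps)
  moreover have "?g (i, j) \<ge> (\<Sum>p\<in>UNIV. ?g p)"
    using member_le_sum[of "(i, j)" UNIV "\<lambda>p. - ?g p"] convexity_gap_nonpos[OF sc A A' t]
    by (simp add: sum_negf)
  ultimately show ?thesis by simp
qed

section \<open>Slopes at zero and at interior points\<close>

text \<open>
  Convexity makes \<open>f'\<close> monotone, so that its limit at \<open>0\<close> exists and the tangent inequality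
  transfers an infinite slope to the chords issuing from \<open>0\<close>.
\<close>

lemma steep_chord:
  fixes f :: "real \<Rightarrow> real"
  assumes sc: "strictly_convex_on {0..1} f" and C1: "C1_on_Ioc f"
    and slope: "bregman_slope f 0 = -\<infinity>" and "0 < d"
  obtains s where "0 < s" "s < d" "s < 1" "f s - f 0 < K * s"
proof -
  obtain g where g: "\<And>t. t \<in> {0<..1} \<Longrightarrow> (f has_real_derivative g t) (at t within {0..1})"
    using C1 unfolding C1_on_Ioc_def by blast
  have vd: "vector_derivative f (at t within {0..1}) = g t" if "t \<in> {0<..<1}" for t
    by (rule vector_derivative_within_closed_interval)
      (use that g[of t] in \<open>auto simp: has_real_derivative_iff_has_vector_derivative\<close>)
  have cvx: "convex_on {0..1} f"
  proof (rule convex_onI)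
    fix t a b :: real assume "t > 0" "t < 1" "a \<in> {0..1}" "b \<in> {0..1}"
    then show "f ((1 - t) *\<^sub>R a + t *\<^sub>R b) \<le> (1 - t) * f a + t * f b"
      using convexity_gap_nonpos[OF sc, of a b t] by (simp add: convexity_gap_def)
  qed simp
  have tangent: "g a * (b - a) \<le> f b - f a" if "a \<in> {0<..<1}" "b \<in> {0..1}" for a b
    by (rule convex_on_imp_above_tangent[OF cvx]) (use that g[of a] in auto)
  have mono: "g a \<le> g b" if "a \<in> {0<..<1}" "b \<in> {0<..<1}" "a \<le> b" for a b
  proof -
    have "g a * (b - a) \<le> f b - f a" "g b * (a - b) \<le> f a - f b"
      using tangent[of a b] tangent[of b a] that by auto
    then have "0 \<le> (g b - g a) * (b - a)"
      by (simp add: algebra_simps)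
    with \<open>a \<le> b\<close> show ?thesis
      by (cases "a = b") (auto simp: zero_le_mult_iff)
  qed
  let ?h = "\<lambda>e. ereal (vector_derivative f (at e within {0..1}))"
  have "(?h \<longlongrightarrow> Inf (?h ` ({0<..} \<inter> {0<..<1}))) (at 0 within ({0<..} \<inter> {0<..<1}))"
    by (rule Lim_right_bound[where K = "-\<infinity>"]) (auto simp: vd mono)
  moreover have "{0<..} \<inter> {0<..<1} = {0<..<1::real}" by auto
  moreover have "at 0 within {0<..<1} = at_right (0::real)"
    by (rule at_within_nhd[of _ "{..<1}"]) auto
  ultimately have lim: "(?h \<longlongrightarrow> Inf (?h ` {0<..<1})) (at_right 0)"
    by simp
  then have "Lim (at_right 0) ?h = Inf (?h ` {0<..<1})"
    by (rule tendsto_Lim[rotated]) simp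
  with slope have "Inf (?h ` {0<..<1}) = -\<infinity>"
    by (simp add: bregman_slope_def)
  with lim have "(?h \<longlongrightarrow> -\<infinity>) (at_right 0)" by simp
  then have "\<forall>\<^sub>F e in at_right 0. ?h e < ereal K"
    by (rule order_tendstoD) simp
  moreover have "\<forall>\<^sub>F e in at_right 0. e \<in> {0<..<min d 1}"
    by (rule eventually_at_right_real) (use \<open>0 < d\<close> in simp)
  ultimately have "\<forall>\<^sub>F e in at_right (0::real). ?h e < ereal K \<and> e \<in> {0<..<min d 1}"
    by (rule eventually_conj)
  then obtain s where s: "?h s < ereal K" "s \<in> {0<..<min d 1}"
    using eventually_happens'[OF trivial_limit_at_right_real] by blast
  then have "g s < K"
    by (simp add: vd)
  moreover have "g s * (0 - s) \<le> f 0 - f s"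
    using s by (intro tangent) auto
  moreover from \<open>g s < K\<close> have "g s * s < K * s"
    by (rule mult_strict_right_mono) (use s(2) in simp)
  ultimately have "f s - f 0 < K * s"
    by argo
  with s that show thesis by auto
qed

text \<open>
  The segment around \<open>A\<close> has to stay among the matrices with entries in \<open>[0,1]\<close>, since \<open>f\<close> is
  constrained only there; an entry equal to \<open>1\<close> is thereby covered by the one-sided
  derivative.
\<close>

lemma real_bregman_directional_derivative:
  fixes A B H :: "real^'n^'n"
  assumes C1: "C1_on_Ioc f" and "0 < d"
    and entry: "\<And>t i j. \<bar>t\<bar> < d \<Longrightarrow> A $ i $ j + t * H $ i $ j \<in> {0..1}"
    and supp: "\<And>i j. A $ i $ j = 0 \<Longrightarrow> H $ i $ j = 0"
  obtains G where "((\<lambda>t. real_bregman f B (A + t *\<^sub>R H)) has_real_derivative G) (at 0)"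
proof -
  obtain g where g: "\<And>t. t \<in> {0<..1} \<Longrightarrow> (f has_real_derivative g t) (at t within {0..1})"
    using C1 unfolding C1_on_Ioc_def by blast
  have df: "((\<lambda>t. f (A $ i $ j + t * H $ i $ j)) has_real_derivative
      g (A $ i $ j) * H $ i $ j) (at 0)" for i j
  proof (cases "A $ i $ j = 0")
    case True
    then show ?thesis using supp[of i j] by simp
  next
    case False
    let ?l = "\<lambda>t. A $ i $ j + t * H $ i $ j"
    have "A $ i $ j \<in> {0<..1}"
      using False entry[of 0 i j] \<open>0 < d\<close> by auto
    then have "(f has_real_derivative g (A $ i $ j)) (at (?l 0) within ?l ` {-d<..<d})"
      using DERIV_subset[OF g[of "A $ i $ j"], of "?l ` {-d<..<d}"] entry by fastforce
    moreover have "(?l has_real_derivative H $ i $ j) (at 0 within {-d<..<d})"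
      by (auto intro!: derivative_eq_intros)
    ultimately have "(f \<circ> ?l has_real_derivative g (A $ i $ j) * H $ i $ j)
        (at 0 within {-d<..<d})"
      by (rule DERIV_image_chain)
    moreover have "at 0 within {-d<..<d} = at 0"
      by (rule at_within_open) (use \<open>0 < d\<close> in auto)
    ultimately show ?thesis by (simp add: o_def)
  qed
  let ?G = "\<Sum>p\<in>UNIV. g (A $ fst p $ snd p) * H $ fst p $ snd p
    - vector_derivative f (at (B $ fst p $ snd p) within {0..1}) * H $ fst p $ snd p"
  have "((\<lambda>t. real_bregman f B (A + t *\<^sub>R H)) has_real_derivative ?G) (at 0)"
    unfolding real_bregman_def
    by (intro DERIV_sum) (auto intro!: derivative_eq_intros df)
  then show thesis by (rule that)
qed

section \<open>Minimising couplings\<close>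

locale regularized_transport =
  fixes f :: "real \<Rightarrow> real" and C :: "real^'n^'n" and x y :: "real^'n"
  assumes strictly_convex: "strictly_convex_on {0..1} f"
    and continuous: "continuous_on {0..1} f"
    and C1: "C1_on_Ioc f"
    and x: "x \<in> prob_simplex" and y: "y \<in> prob_simplex"
begin

abbreviation E :: "real^'n^'n \<Rightarrow> real" where "E \<equiv> real_bregman f (tensor x y)"

abbreviation objective :: "real \<Rightarrow> real^'n^'n \<Rightarrow> real" where
  "objective \<gamma> A \<equiv> C \<bullet> A + \<gamma> * E A"

abbreviation P :: "real \<Rightarrow> real^'n^'n" where "P \<equiv> min_coupling f C x y"

lemma entry: "A \<in> couplings x y \<Longrightarrow> A $ i $ j \<in> {0..1}"
  using couplings_entry[OF x] .

lemma tensor_coupling: "tensor x y \<in> couplings x y"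
  using tensor_in_couplings[OF x y] .

lemma mat_bregman_coupling:
  "A \<in> couplings x y \<Longrightarrow> mat_bregman f A (tensor x y) = ereal (E A)"
  by (rule mat_bregman_eq_real) (rule couplings_vanish)

lemma is_coupling_min_iff:
  "is_coupling_min f C x y \<gamma> A \<longleftrightarrow>
    A \<in> couplings x y \<and> (\<forall>B\<in>couplings x y. objective \<gamma> A \<le> objective \<gamma> B)"
proof -
  have "reg_cost f C x y \<gamma> B = ereal (objective \<gamma> B)" if "B \<in> couplings x y" for B
    using that by (simp add: reg_cost_def mat_bregman_coupling)
  then show ?thesis
    by (auto simp: is_coupling_min_def is_arg_min_linorder)
qed

lemma objective_convex_gap:
  assumes "A \<in> couplings x y" "B \<in> couplings x y" "0 \<le> t" "t \<le> 1" "0 \<le> \<gamma>"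
  shows "objective \<gamma> ((1 - t) *\<^sub>R A + t *\<^sub>R B)
    \<le> (1 - t) * objective \<gamma> A + t * objective \<gamma> B
      + \<gamma> * convexity_gap f t (A $ i $ j) (B $ i $ j)"
proof -
  have "\<gamma> * E ((1 - t) *\<^sub>R A + t *\<^sub>R B)
      \<le> \<gamma> * ((1 - t) * E A + t * E B + convexity_gap f t (A $ i $ j) (B $ i $ j))"
    using assms
    by (intro mult_left_mono real_bregman_convex_gap[OF strictly_convex]) (auto dest: entry)
  then show ?thesis
    by (simp add: inner_right_distrib algebra_simps)
qed

lemma coupling_min_unique:
  assumes "0 < \<gamma>" and A: "is_coupling_min f C x y \<gamma> A" and B: "is_coupling_min f C x y \<gamma> B"
  shows "A = B"
proof (rule ccontr)
  assume "A \<noteq> B"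
  then obtain i j where ne: "A $ i $ j \<noteq> B $ i $ j"
    by (auto simp: vec_eq_iff)
  have K: "A \<in> couplings x y" "B \<in> couplings x y"
    using A B by (auto simp: is_coupling_min_iff)
  let ?M = "(1 - 1/2) *\<^sub>R A + (1/2::real) *\<^sub>R B"
  have "?M \<in> couplings x y"
    using convex_couplings K by (rule convexD_alt) auto
  then have "objective \<gamma> A \<le> objective \<gamma> ?M"
    using A by (auto simp: is_coupling_min_iff)
  also have "\<dots> \<le> (1 - 1/2) * objective \<gamma> A + 1/2 * objective \<gamma> B
      + \<gamma> * convexity_gap f (1/2) (A $ i $ j) (B $ i $ j)"
    using K \<open>0 < \<gamma>\<close> by (intro objective_convex_gap) auto
  also have "objective \<gamma> B = objective \<gamma> A"
    using A B by (auto simp: is_coupling_min_iff intro: order.antisym)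
  finally have "0 \<le> \<gamma> * convexity_gap f (1/2) (A $ i $ j) (B $ i $ j)"
    by simp
  moreover have "\<forall>t. 0 < t \<and> t < 1 \<longrightarrow> convexity_gap f t (A $ i $ j) (B $ i $ j) < 0"
    using strictly_convex ne entry[OF K(1), of i j] entry[OF K(2), of i j]
    unfolding strictly_convex_on_def convexity_gap_def by simp
  then have "convexity_gap f (1/2) (A $ i $ j) (B $ i $ j) < 0"
    by simp
  ultimately show False
    using \<open>0 < \<gamma>\<close> by (simp add: zero_le_mult_iff)
qed

lemma P_minimizes:
  assumes "0 < \<gamma>" shows "is_coupling_min f C x y \<gamma> (P \<gamma>)"
proof -
  have "continuous_on (couplings x y) (objective \<gamma>)"
    using continuous entry by (intro continuous_intros continuous_on_real_bregman)
  then obtain A where A: "is_coupling_min f C x y \<gamma> A"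
    using continuous_attains_inf[OF compact_couplings[OF x]] tensor_coupling
    unfolding is_coupling_min_iff by blast
  show ?thesis
    unfolding min_coupling_def using A coupling_min_unique[OF assms _ A] by (rule theI)
qed

lemma P_coupling: "0 < \<gamma> \<Longrightarrow> P \<gamma> \<in> couplings x y"
  using P_minimizes by (auto simp: is_coupling_min_iff)

lemma P_optimal: "0 < \<gamma> \<Longrightarrow> B \<in> couplings x y \<Longrightarrow> objective \<gamma> (P \<gamma>) \<le> objective \<gamma> B"
  using P_minimizes by (auto simp: is_coupling_min_iff)

lemma min_divergence_eq: "0 < \<gamma> \<Longrightarrow> min_divergence f C x y \<gamma> = ereal (E (P \<gamma>))"
  by (simp add: min_divergence_def mat_bregman_coupling P_coupling)

lemma P_tradeoff:
  assumes "0 < a" "a \<le> b"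
  shows "C \<bullet> P a \<le> C \<bullet> P b" and "E (P b) \<le> E (P a)"
proof -
  have "C \<bullet> P a \<le> C \<bullet> P b \<and> E (P b) \<le> E (P a)"
  proof (cases "a = b")
    case False
    then show ?thesis
      using assms argmin_tradeoff[of a b "\<lambda>A. C \<bullet> A" "P a" E "P b"] P_optimal[of a "P b"]
        P_optimal[of b "P a"] P_coupling[of a] P_coupling[of b] by auto
  qed simp
  then show "C \<bullet> P a \<le> C \<bullet> P b" "E (P b) \<le> E (P a)" by auto
qed

lemma P_eq_if_cost_or_divergence_eq:
  assumes "0 < a" "0 < b" and eq: "C \<bullet> P a = C \<bullet> P b \<or> E (P a) = E (P b)"
  shows "P a = P b"
proof -
  have pos: "0 < a" "0 < b" by fact+
  have opt: "objective a (P a) \<le> objective a (P b)" "objective b (P b) \<le> objective b (P a)"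
    using pos by (auto intro: P_optimal P_coupling)
  have "C \<bullet> P a = C \<bullet> P b \<and> E (P a) = E (P b)"
    using eq
  proof
    assume "C \<bullet> P a = C \<bullet> P b"
    with opt pos show ?thesis by simp
  next
    assume "E (P a) = E (P b)"
    with opt show ?thesis by simp
  qed
  then have "objective a (P b) = objective a (P a)" by simp
  then have "is_coupling_min f C x y a (P b)"
    using pos P_minimizes[of a] P_coupling[of b] by (simp add: is_coupling_min_iff)
  then show ?thesis
    using coupling_min_unique P_minimizes pos by blast
qed

section \<open>Infinite slope at zero\<close>

text \<open>
  Moving by a fraction \<open>t\<close> from \<open>P\<close> towards \<open>x \<otimes> y\<close> changes the objective by at most a multiple of \<open>t\<close>,
  plus the gap at a vanishing entry of \<open>P\<close>, which is more negative than any multiple of \<open>t\<close>.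
\<close>

lemma minimizer_positive:
  assumes slope: "bregman_slope f 0 = -\<infinity>" and "0 < \<gamma>" and supp: "tensor x y $ i $ j \<noteq> 0"
  shows "0 < P \<gamma> $ i $ j"
proof (rule ccontr)
  let ?U = "tensor x y" and ?A = "P \<gamma>"
  let ?u = "?U $ i $ j"
  assume "\<not> 0 < ?A $ i $ j"
  with couplings_nonneg[OF P_coupling[OF \<open>0 < \<gamma>\<close>], of i j] have zero: "?A $ i $ j = 0"
    by simp
  have u: "0 < ?u" "?u \<le> 1"
    using entry[OF tensor_coupling, of i j] supp by auto
  define K where "K = (objective \<gamma> ?A - objective \<gamma> ?U) / \<gamma> + f ?u - f 0"
  obtain s where s: "0 < s" "s < ?u" "f s - f 0 < K / ?u * s"
    using steep_chord[OF strictly_convex C1 slope u(1)] by metis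
  define t where "t = s / ?u"
  have t: "0 \<le> t" "t \<le> 1" "t * ?u = s"
    using s u by (auto simp: t_def)
  have "(1 - t) *\<^sub>R ?A + t *\<^sub>R ?U \<in> couplings x y"
    using convex_couplings P_coupling[OF \<open>0 < \<gamma>\<close>] tensor_coupling t(1,2) by (rule convexD_alt)
  then have "objective \<gamma> ?A \<le> objective \<gamma> ((1 - t) *\<^sub>R ?A + t *\<^sub>R ?U)"
    by (rule P_optimal[OF \<open>0 < \<gamma>\<close>])
  also have "\<dots> \<le> (1 - t) * objective \<gamma> ?A + t * objective \<gamma> ?U
      + \<gamma> * convexity_gap f t (?A $ i $ j) ?u"
    using \<open>0 < \<gamma>\<close> t(1,2) by (intro objective_convex_gap P_coupling tensor_coupling) auto
  finally have "t * (objective \<gamma> ?A - objective \<gamma> ?U) \<le> \<gamma> * convexity_gap f t 0 ?u"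
    by (simp add: zero algebra_simps)
  also have "convexity_gap f t 0 ?u = f s - f 0 - t * (f ?u - f 0)"
    by (simp add: convexity_gap_def t(3) algebra_simps)
  finally have "t * ((objective \<gamma> ?A - objective \<gamma> ?U) / \<gamma>) \<le> f s - f 0 - t * (f ?u - f 0)"
    using \<open>0 < \<gamma>\<close> by (simp add: pos_divide_le_eq mult.commute)
  then have "t * K \<le> f s - f 0"
    by (simp add: K_def algebra_simps)
  with s(3) show False
    by (simp add: t_def mult.commute)
qed

text \<open>
  Positivity of the minimiser makes \<open>H\<close> admissible in both directions, so both objectives are
  stationary along \<open>H\<close>; their derivatives differ only in the weight of the divergence part.
\<close>

lemma cost_balanced_zero:
  assumes slope: "bregman_slope f 0 = -\<infinity>" and "0 < a" "0 < b" "a \<noteq> b" and eq: "P a = P b"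
    and rows: "\<And>i. (\<Sum>j\<in>UNIV. H $ i $ j) = 0" and cols: "\<And>j. (\<Sum>i\<in>UNIV. H $ i $ j) = 0"
    and supp: "\<And>i j. tensor x y $ i $ j = 0 \<Longrightarrow> H $ i $ j = 0"
  shows "C \<bullet> H = 0"
proof -
  let ?A = "P a"
  have A: "?A \<in> couplings x y"
    using \<open>0 < a\<close> by (rule P_coupling)
  have zero: "H $ i $ j = 0" if "?A $ i $ j = 0" for i j
    using that supp[of i j] minimizer_positive[OF slope \<open>0 < a\<close>, of i j] by auto
  have "\<forall>\<^sub>F t in nhds 0. 0 \<le> ?A $ i $ j + t * H $ i $ j" for i j
  proof (cases "?A $ i $ j = 0")
    case True
    then show ?thesis by (simp add: zero)
  next
    case False
    have "((\<lambda>t. ?A $ i $ j + t * H $ i $ j) \<longlongrightarrow> ?A $ i $ j + 0 * H $ i $ j) (nhds 0)"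
      by (intro tendsto_intros filterlim_ident)
    moreover have "0 < ?A $ i $ j"
      using False couplings_nonneg[OF A, of i j] by simp
    ultimately have "\<forall>\<^sub>F t in nhds 0. 0 < ?A $ i $ j + t * H $ i $ j"
      by (intro order_tendstoD) auto
    then show ?thesis by (rule eventually_mono) simp
  qed
  then have "\<forall>\<^sub>F t in nhds 0. \<forall>i j. 0 \<le> ?A $ i $ j + t * H $ i $ j"
    by (intro eventually_all_finite)
  then obtain d where d: "0 < d" "\<And>t i j. \<bar>t\<bar> < d \<Longrightarrow> 0 \<le> ?A $ i $ j + t * H $ i $ j"
    unfolding eventually_nhds_metric by (auto simp: dist_real_def)
  have line: "?A + t *\<^sub>R H \<in> couplings x y" if "\<bar>t\<bar> < d" for t
    using d(2)[OF that] by (rule couplings_perturb[OF A rows cols])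
  obtain G where G: "((\<lambda>t. E (?A + t *\<^sub>R H)) has_real_derivative G) (at 0)"
    using real_bregman_directional_derivative[OF C1 d(1), of ?A H "tensor x y"] entry[OF line] zero
    by auto
  have stationary: "C \<bullet> H + \<gamma> * G = 0" if "0 < \<gamma>" "P \<gamma> = ?A" for \<gamma>
  proof (rule DERIV_local_min)
    show "((\<lambda>t. objective \<gamma> (?A + t *\<^sub>R H)) has_real_derivative C \<bullet> H + \<gamma> * G) (at 0)"
      unfolding inner_add_right inner_scaleR_right
      by (auto intro!: derivative_eq_intros G)
    show "\<forall>t. \<bar>0 - t\<bar> < d \<longrightarrow>
        objective \<gamma> (?A + 0 *\<^sub>R H) \<le> objective \<gamma> (?A + t *\<^sub>R H)"
      using P_optimal[OF \<open>0 < \<gamma>\<close> line] that(2) by simp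
  qed (rule d(1))
  have "C \<bullet> H + a * G = 0" "C \<bullet> H + b * G = 0"
    using stationary[of a] stationary[of b] \<open>0 < a\<close> \<open>0 < b\<close> eq by auto
  moreover from this have "(a - b) * G = 0"
    unfolding left_diff_distrib by linarith
  ultimately show ?thesis
    using \<open>a \<noteq> b\<close> by simp
qed

lemma cyclically_monotone_if_P_eq:
  assumes slope: "bregman_slope f 0 = -\<infinity>" and ab: "0 < a" "0 < b" "a \<noteq> b" "P a = P b"
  shows "cyclically_monotone C (mat_supp (tensor x y))"
  unfolding cyclically_monotone_def
proof (intro allI impI)
  fix M :: nat and i j :: "nat \<Rightarrow> 'n" and \<sigma>
  assume "(\<forall>m\<in>{1..M}. (i m, j m) \<in> mat_supp (tensor x y)) \<and> \<sigma> permutes {1..M}"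
  then have supp: "\<And>m. m \<in> {1..M} \<Longrightarrow> x $ i m \<noteq> 0 \<and> y $ j m \<noteq> 0"
    and \<sigma>: "\<sigma> permutes {1..M}"
    by (auto simp: mat_supp_def tensor_def)
  \<comment> \<open>Mass is moved from the points of the family to the rearranged ones; a product support
      contains the latter.\<close>
  define H :: "real^'n^'n" where
    "H = (\<Sum>m=1..M. axis (i (\<sigma> m)) (axis (j m) 1) - axis (i m) (axis (j m) 1))"
  have H: "H $ k $ l = (\<Sum>m=1..M. (if k = i (\<sigma> m) \<and> l = j m then 1 else 0)
      - (if k = i m \<and> l = j m then 1 else 0))" for k l
    unfolding H_def sum_component vector_minus_component
    by (intro sum.cong) (auto simp: axis_def)
  have "C \<bullet> H = 0"
  proof (rule cost_balanced_zero[OF slope ab])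
    fix k
    have "(\<Sum>l\<in>UNIV. H $ k $ l)
        = (\<Sum>m=1..M. \<Sum>l\<in>UNIV. (if k = i (\<sigma> m) \<and> l = j m then 1 else 0)
            - (if k = i m \<and> l = j m then 1 else 0))"
      unfolding H by (rule sum.swap)
    also have "\<dots> = (\<Sum>m=1..M. (if k = i (\<sigma> m) then 1 else 0) - (if k = i m then 1 else 0))"
      by (intro sum.cong) (auto simp: sum_subtractf)
    also have "\<dots> = 0"
      using sum.permute[OF \<sigma>, of "\<lambda>m. if k = i m then 1 else (0::real)"]
      by (simp add: sum_subtractf o_def)
    finally show "(\<Sum>l\<in>UNIV. H $ k $ l) = 0" .
  next
    fix l
    have "(\<Sum>k\<in>UNIV. H $ k $ l)
        = (\<Sum>m=1..M. \<Sum>k\<in>UNIV. (if k = i (\<sigma> m) \<and> l = j m then 1 else 0)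
            - (if k = i m \<and> l = j m then 1 else 0))"
      unfolding H by (rule sum.swap)
    also have "\<dots> = 0"
    proof (rule sum.neutral, rule ballI)
      fix m
      show "(\<Sum>k\<in>UNIV. (if k = i (\<sigma> m) \<and> l = j m then 1 else 0)
            - (if k = i m \<and> l = j m then 1 else 0)) = (0::real)"
        by (cases "l = j m") (simp_all add: sum_subtractf)
    qed
    finally show "(\<Sum>k\<in>UNIV. H $ k $ l) = 0" .
  next
    fix k l
    assume "tensor x y $ k $ l = 0"
    then have kl: "x $ k = 0 \<or> y $ l = 0"
      by (simp add: tensor_def)
    have "x $ i (\<sigma> m) \<noteq> 0" if "m \<in> {1..M}" for m
      using supp[of "\<sigma> m"] that permutes_in_image[OF \<sigma>, of m] by simp
    then show "H $ k $ l = 0"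
      unfolding H using kl supp by (intro sum.neutral) auto
  qed
  then have "(\<Sum>m=1..M. C $ i (\<sigma> m) $ j m) - (\<Sum>m=1..M. C $ i m $ j m) = 0"
    by (simp add: H_def inner_sum_right inner_diff_right inner_axis sum_subtractf)
  then show "(\<Sum>m=1..M. C $ i m $ j m) \<le> (\<Sum>m=1..M. C $ i (\<sigma> m) $ j m)"
    by simp
qed

end

section \<open>Monotonicity of cost and divergence\<close>

theorem theorem3p13:
  fixes f :: "real \<Rightarrow> real" and C :: "real^'n^'n" and x y :: "real^'n"
  assumes "CARD('n) \<ge> 2"
    and "strictly_convex_on {0..1} f" and "continuous_on {0..1} f" and "C1_on_Ioc f"
    and "x \<in> prob_simplex" and "y \<in> prob_simplex"
  shows "mono_on {0<..} (min_cost f C x y) \<and>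
    mono_on {0<..} (\<lambda>\<gamma>. - min_divergence f C x y \<gamma>) \<and>
    (\<forall>\<gamma>0>0. \<forall>\<gamma>1>0.
       min_cost f C x y \<gamma>0 = min_cost f C x y \<gamma>1 \<or>
       min_divergence f C x y \<gamma>0 = min_divergence f C x y \<gamma>1 \<longrightarrow>
       min_coupling f C x y \<gamma>0 = min_coupling f C x y \<gamma>1) \<and>
    (\<not> cyclically_monotone C (mat_supp (tensor x y)) \<and> bregman_slope f 0 = -\<infinity> \<longrightarrow>
       strict_mono_on {0<..} (min_cost f C x y) \<and>
       strict_mono_on {0<..} (\<lambda>\<gamma>. - min_divergence f C x y \<gamma>))"
proof -
  interpret regularized_transport f C x y
    by unfold_locales fact+
  have eqI: "P a = P b" if "0 < a" "0 < b"
    "min_cost f C x y a = min_cost f C x y b \<or> min_divergence f C x y a = min_divergence f C x y b"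
    for a b
    using that P_eq_if_cost_or_divergence_eq[of a b] by (auto simp: min_cost_def min_divergence_eq)
  have mono: "mono_on {0<..} (min_cost f C x y)"
    "mono_on {0<..} (\<lambda>\<gamma>. - min_divergence f C x y \<gamma>)"
    by (auto intro!: mono_onI simp: min_cost_def min_divergence_eq P_tradeoff)
  have strict: "strict_mono_on {0<..} (min_cost f C x y) \<and>
      strict_mono_on {0<..} (\<lambda>\<gamma>. - min_divergence f C x y \<gamma>)"
    if "\<not> cyclically_monotone C (mat_supp (tensor x y))" "bregman_slope f 0 = -\<infinity>"
  proof -
    have ne: "P a \<noteq> P b" if "0 < a" "a < b" for a b
      using cyclically_monotone_if_P_eq[of a b] that
        \<open>\<not> cyclically_monotone C (mat_supp (tensor x y))\<close> \<open>bregman_slope f 0 = -\<infinity>\<close> by auto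
    have "min_cost f C x y a < min_cost f C x y b \<and>
        - min_divergence f C x y a < - min_divergence f C x y b" if "0 < a" "a < b" for a b
      using mono_onD[OF mono(1), of a b] mono_onD[OF mono(2), of a b] eqI[of a b] ne[of a b] that
      by (auto simp: less_le)
    then show ?thesis
      by (auto intro!: strict_mono_onI)
  qed
  show ?thesis
    using mono eqI strict by blast
qed

end
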